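(* Let $S_6$ be a Seidel matrix of order $6$ with spectrum $\{[-\sqrt{5}]^3,[\sqrt{5}]^3\}$. For $k\in\{1,2\}$, the Seidel matrices $\pm\left(J_{2k+1}\otimes(S_6-I_6)+I_{6(2k+1)}\right)$ do not contain any regular graph in their switching class; that is, none of these matrices (of orders $18$ and $30$) is equivalent to a Seidel matrix whose ambient graph is regular.
   Context: A Seidel matrix of order $n$ is an $n\times n$ symmetric matrix with zero diagonal and all off-diagonal entries equal to $\pm1$. Two Seidel matrices $S_1,S_2$ of the same order are equivalent if $S_2=PS_1P^T$ for some signed permutation matrix $P$. The ambient graph of $S$ is the simple graph with adjacency matrix $(J-I-S)/2$, where $J$ is the all-ones matrix. The switching class of $S$ is the set of (isomorphism classes of) ambient graphs of Seidel matrices equivalent to $S$. $J_a$ and $I_a$ are the all-ones and identity matrices of order $a$, and $\otimes$ is the Kronecker product. $[\lambda]^a$ in a spectrum means that the eigenvalue $\lambda$ has multiplicity $a$. *)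

theory Defs
  imports
    Complex_Main
    "Jordan_Normal_Form.Char_Poly"
    "Graph_Theory.Graph_Theory"
begin

section \<open>Matrices\<close>

definition all_ones_mat :: "nat \<Rightarrow> real mat" where
  "all_ones_mat n = mat n n (\<lambda>_. 1)"

definition kronecker_prod :: "'a::semiring_0 mat \<Rightarrow> 'a mat \<Rightarrow> 'a mat" (infixl "\<otimes>\<^sub>K" 70) where
  "A \<otimes>\<^sub>K B = mat (dim_row A * dim_row B) (dim_col A * dim_col B)
     (\<lambda>(i, j). A $$ (i div dim_row B, j div dim_col B) * B $$ (i mod dim_row B, j mod dim_col B))"

definition signed_permutation_mat :: "nat \<Rightarrow> real mat \<Rightarrow> bool" where
  "signed_permutation_mat n P \<longleftrightarrow> P \<in> carrier_mat n n \<and>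
     (\<forall>i<n. \<forall>j<n. P $$ (i, j) \<in> {-1, 0, 1}) \<and>
     (\<forall>i<n. \<exists>!j. j < n \<and> P $$ (i, j) \<noteq> 0) \<and>
     (\<forall>j<n. \<exists>!i. i < n \<and> P $$ (i, j) \<noteq> 0)"

definition seidel_mat :: "nat \<Rightarrow> real mat \<Rightarrow> bool" where
  "seidel_mat n S \<longleftrightarrow> S \<in> carrier_mat n n \<and> transpose_mat S = S \<and>
     (\<forall>i<n. S $$ (i, i) = 0) \<and>
     (\<forall>i<n. \<forall>j<n. i \<noteq> j \<longrightarrow> S $$ (i, j) \<in> {-1, 1})"

definition seidel_equiv :: "real mat \<Rightarrow> real mat \<Rightarrow> bool" where
  "seidel_equiv S\<^sub>1 S\<^sub>2 \<longleftrightarrow> (\<exists>n. seidel_mat n S\<^sub>1 \<and> seidel_mat n S\<^sub>2 \<and>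
     (\<exists>P. signed_permutation_mat n P \<and> S\<^sub>2 = P * S\<^sub>1 * transpose_mat P))"

section \<open>Ambient graphs and switching classes\<close>

text \<open>Simple graphs are represented as loop-free symmetric digraphs without parallel arcs,
  i.e. as instances of the locale \<^locale>\<open>pair_graph\<close>.\<close>

definition graph_of_adjacency_mat :: "real mat \<Rightarrow> nat pair_pre_digraph" where
  "graph_of_adjacency_mat A = \<lparr> pverts = {..<dim_row A},
     parcs = {(i, j). i < dim_row A \<and> j < dim_row A \<and> A $$ (i, j) = 1} \<rparr>"

definition ambient_graph :: "real mat \<Rightarrow> nat pair_pre_digraph" where
  "ambient_graph S = graph_of_adjacency_mat
     ((1 / 2) \<cdot>\<^sub>m (all_ones_mat (dim_row S) - 1\<^sub>m (dim_row S) - S))"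

text \<open>The switching class consists of isomorphism classes of graphs; it is represented by the
  union of these classes, restricted to graphs whose vertices are natural numbers.\<close>

definition switching_class :: "real mat \<Rightarrow> nat pair_pre_digraph set" where
  "switching_class S = {G. \<exists>T. seidel_equiv S T \<and>
     digraph_iso (with_proj (ambient_graph T)) (with_proj G)}"

text \<open>Each edge of a simple graph is a pair of opposite arcs, so the degree of a vertex is its
  out-degree.\<close>

definition regular_graph :: "nat pair_pre_digraph \<Rightarrow> bool" where
  "regular_graph G \<longleftrightarrow> (\<exists>d. \<forall>v \<in> pverts G. out_degree (with_proj G) v = d)"

section \<open>Well-definedness\<close>

lemma seidel_mat_sym:
  assumes "seidel_mat n S" "i < n" "j < n"
  shows "S $$ (i, j) = S $$ (j, i)"
proof -
  have dim: "S \<in> carrier_mat n n" and sym: "transpose_mat S = S"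
    using assms by (auto simp: seidel_mat_def)
  have "transpose_mat S $$ (i, j) = S $$ (j, i)" using dim assms(2,3) by simp
  then show ?thesis unfolding sym .
qed

lemma seidel_mat_uminus:
  assumes "seidel_mat n S"
  shows "seidel_mat n (- S)"
proof -
  have dim: "S \<in> carrier_mat n n" using assms by (simp add: seidel_mat_def)
  have "transpose_mat (- S) = - S"
    using dim seidel_mat_sym[OF assms] by (intro eq_matI) auto
  moreover have "(- S) $$ (i, j) = - (S $$ (i, j))" if "i < n" "j < n" for i j
    using dim that by simp
  ultimately show ?thesis using assms by (fastforce simp: seidel_mat_def)
qed

lemma seidel_mat_kronecker:
  assumes S: "seidel_mat n S"
  shows "seidel_mat (n * a) (all_ones_mat a \<otimes>\<^sub>K (S - 1\<^sub>m n) + 1\<^sub>m (n * a))" (is "seidel_mat _ ?M")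
proof -
  have dim: "S \<in> carrier_mat n n" using S by (simp add: seidel_mat_def)
  have bound: "i div n < a \<and> i mod n < n" if "i < n * a" for i
    using that by (metis gr_zeroI less_mult_imp_div_less mod_less_divisor mult.commute mult_0 not_less_zero)
  have entry: "?M $$ (i, j) = S $$ (i mod n, j mod n) - (if i mod n = j mod n then 1 else 0)
      + (if i = j then 1 else 0)" if "i < n * a" "j < n * a" for i j
    using that bound[of i] bound[of j] dim
    by (auto simp: kronecker_prod_def all_ones_mat_def mult.commute)
  have carrier: "?M \<in> carrier_mat (n * a) (n * a)"
    by (auto simp: mult.commute)
  have "transpose_mat ?M = ?M"
  proof (rule eq_matI)
    fix i j assume "i < dim_row ?M" "j < dim_col ?M"
    then have ij: "i < n * a" "j < n * a" using carrier by auto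
    have "transpose_mat ?M $$ (i, j) = ?M $$ (j, i)" using ij carrier by auto
    also have "\<dots> = ?M $$ (i, j)"
      unfolding entry[OF ij] entry[OF ij(2,1)]
      using seidel_mat_sym[OF S, of "i mod n" "j mod n"] bound[OF ij(1)] bound[OF ij(2)] by auto
    finally show "transpose_mat ?M $$ (i, j) = ?M $$ (i, j)" .
  qed (use carrier in auto)
  moreover have "?M $$ (i, i) = 0" if "i < n * a" for i
    unfolding entry[OF that that] using S bound[OF that] by (simp add: seidel_mat_def)
  moreover have "?M $$ (i, j) \<in> {-1, 1}" if "i < n * a" "j < n * a" "i \<noteq> j" for i j
    unfolding entry[OF that(1,2)] using S bound[OF that(1)] bound[OF that(2)] that(3)
    by (auto simp: seidel_mat_def)
  ultimately show ?thesis using carrier by (auto simp: seidel_mat_def)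
qed

lemma ambient_graph_simple:
  assumes "seidel_mat n S"
  shows "pair_graph (ambient_graph S)"
proof -
  have dim: "S \<in> carrier_mat n n" using assms by (simp add: seidel_mat_def)
  let ?A = "(1 / 2) \<cdot>\<^sub>m (all_ones_mat n - 1\<^sub>m n - S)"
  have entry: "?A $$ (i, j) = (1 - (if i = j then 1 else 0) - S $$ (i, j)) / 2"
    if "i < n" "j < n" for i j
    using that dim by (simp add: all_ones_mat_def)
  have diag: "S $$ (i, i) = 0" if "i < n" for i
    using assms that by (simp add: seidel_mat_def)
  have iff: "?A $$ (i, j) = 1 \<longleftrightarrow> i \<noteq> j \<and> S $$ (i, j) = -1" if "i < n" "j < n" for i j
    unfolding entry[OF that] using diag[OF that(1)] by (cases "i = j") auto
  have graph: "ambient_graph S = graph_of_adjacency_mat ?A" and row: "dim_row ?A = n"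
    using dim by (simp_all add: ambient_graph_def)
  have arcs: "parcs (ambient_graph S) = {(i, j). i < n \<and> j < n \<and> i \<noteq> j \<and> S $$ (i, j) = -1}"
    unfolding graph graph_of_adjacency_mat_def row using iff by auto
  have verts: "pverts (ambient_graph S) = {..<n}"
    unfolding graph graph_of_adjacency_mat_def row by simp
  have "parcs (ambient_graph S) \<subseteq> {..<n} \<times> {..<n}" unfolding arcs by blast
  then have fin: "finite (parcs (ambient_graph S))" by (rule finite_subset) simp
  have "sym (parcs (ambient_graph S))"
  proof (rule symI)
    fix i j assume "(i, j) \<in> parcs (ambient_graph S)"
    then show "(j, i) \<in> parcs (ambient_graph S)"
      unfolding arcs using seidel_mat_sym[OF assms, of i j] by simp
  qed
  then have "symmetric (with_proj (ambient_graph S))" by (simp add: symmetric_def)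
  with fin show ?thesis
    by unfold_locales (auto simp: arcs verts)
qed

end

theory Submission
  imports Defs
begin

text \<open>A Seidel matrix with regular ambient graph has constant integer row sums, so if it is
  equivalent to \<open>M\<close> or \<open>-M\<close>, where \<open>M = J \<otimes> (S - I) + I\<close>, then \<open>M\<close> has an eigenvector \<open>x\<close> with
  entries \<open>\<plusminus>1\<close> for some integer eigenvalue \<open>r\<close>. Adding up the \<open>m\<close> blocks of \<open>x\<close> gives a vector \<open>y\<close>
  with \<open>S y = ((r - 1) / m + 1) y\<close>, whose entries are odd because \<open>m\<close> is odd, so that \<open>y\<close> is not
  zero. Hence \<open>S\<close> has a rational eigenvalue, whereas its eigenvalues are \<open>\<plusminus>\<surd>5\<close>.\<close>

text \<open>A rational algebraic integer is an integer, but no integer lies strictly between 2 and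
  3.\<close>

lemma sqrt_5_irrational: "sqrt 5 \<notin> \<rat>"
proof
  assume "sqrt 5 \<in> \<rat>"
  moreover have "algebraic_int (sqrt 5)" by (intro algebraic_int_sqrt) auto
  ultimately have "sqrt 5 \<in> \<int>" by (rule rational_algebraic_int_is_int[rotated])
  then obtain z where z: "sqrt 5 = of_int z" by (elim Ints_cases)
  have "2 < sqrt 5" by (rule real_less_rsqrt) simp
  moreover have "sqrt 5 < 3" by (rule real_less_lsqrt) simp_all
  ultimately have "2 < z" "z < 3" unfolding z by auto
  then show False by linarith
qed

section \<open>Signed permutation matrices\<close>

lemma signed_permutation_mat_transpose:
  assumes "signed_permutation_mat n P"
  shows "signed_permutation_mat n (transpose_mat P)"
proof -
  have dim: "P \<in> carrier_mat n n" using assms by (simp add: signed_permutation_mat_def)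
  have "(\<exists>!j. j < n \<and> transpose_mat P $$ (i, j) \<noteq> 0) \<longleftrightarrow> (\<exists>!j. j < n \<and> P $$ (j, i) \<noteq> 0)"
    if "i < n" for i
    using dim that by (intro arg_cong[where f = Ex1] ext) auto
  moreover have "(\<exists>!i. i < n \<and> transpose_mat P $$ (i, j) \<noteq> 0) \<longleftrightarrow> (\<exists>!i. i < n \<and> P $$ (j, i) \<noteq> 0)"
    if "j < n" for j
    using dim that by (intro arg_cong[where f = Ex1] ext) auto
  ultimately show ?thesis
    using assms dim by (simp add: signed_permutation_mat_def)
qed

text \<open>Only one entry of the row is non-zero, and \<open>f 0 = 0\<close> kills all other terms.
  Squaring as \<open>f\<close> gives the diagonal of \<open>transpose_mat P * P\<close>; the
  identity as \<open>f\<close> gives the entries of \<open>transpose_mat P\<close> times the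
  all-ones vector.\<close>

lemma signed_permutation_mat_row_sum:
  fixes f :: "real \<Rightarrow> real"
  assumes "signed_permutation_mat n P" "i < n" "f 0 = 0"
  shows "\<exists>e\<in>{-1, 1}. (\<Sum>j<n. f (P $$ (i, j))) = f e"
proof -
  have "\<exists>!j. j < n \<and> P $$ (i, j) \<noteq> 0"
    using assms(1,2) by (simp only: signed_permutation_mat_def)
  then obtain j where j: "j < n" "P $$ (i, j) \<noteq> 0"
    and uniq: "\<And>k. k < n \<Longrightarrow> P $$ (i, k) \<noteq> 0 \<Longrightarrow> k = j"
    by blast
  have "(\<Sum>k<n. f (P $$ (i, k))) = (\<Sum>k<n. if k = j then f (P $$ (i, j)) else 0)"
  proof (rule sum.cong)
    fix k assume k: "k \<in> {..<n}"
    show "f (P $$ (i, k)) = (if k = j then f (P $$ (i, j)) else 0)"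
    proof (cases "k = j")
      case False
      then have "P $$ (i, k) = 0" using uniq[of k] k by blast
      then show ?thesis using False assms(3) by simp
    qed simp
  qed simp
  also have "\<dots> = f (P $$ (i, j))" using j(1) by simp
  finally have sum: "(\<Sum>k<n. f (P $$ (i, k))) = f (P $$ (i, j))" .
  have "P $$ (i, j) \<in> {-1, 0, 1}"
    using assms(1,2) j(1) by (simp only: signed_permutation_mat_def)
  then have "P $$ (i, j) \<in> {-1, 1}" using j(2) by simp
  with sum show ?thesis by (rule bexI[of _ "P $$ (i, j)"])
qed

lemma signed_permutation_mat_orthogonal:
  assumes P: "signed_permutation_mat n P"
  shows "transpose_mat P * P = 1\<^sub>m n"
proof (rule eq_matI)
  have dim: "P \<in> carrier_mat n n" using P by (simp add: signed_permutation_mat_def)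
  fix i j assume "i < dim_row (1\<^sub>m n :: real mat)" "j < dim_col (1\<^sub>m n :: real mat)"
  then have ij: "i < n" "j < n" by auto
  have prod: "(transpose_mat P * P) $$ (i, j) = (\<Sum>k<n. P $$ (k, i) * P $$ (k, j))"
    using dim ij by (simp add: scalar_prod_def atLeast0LessThan)
  show "(transpose_mat P * P) $$ (i, j) = 1\<^sub>m n $$ (i, j)"
  proof (cases "i = j")
    case True
    have "\<exists>e\<in>{-1, 1}. (\<Sum>k<n. (transpose_mat P $$ (i, k))\<^sup>2) = e\<^sup>2"
      by (rule signed_permutation_mat_row_sum[OF signed_permutation_mat_transpose[OF P] ij(1)]) simp
    then have "(\<Sum>k<n. P $$ (k, i) * P $$ (k, i)) = 1"
      using dim ij by (auto simp: power2_eq_square)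
    then show ?thesis using prod True ij by simp
  next
    case False
    \<comment> \<open>Two different columns have disjoint supports, since row \<open>k\<close> has a
      single non-zero entry.\<close>
    have "P $$ (k, i) * P $$ (k, j) = 0" if "k < n" for k
    proof -
      have "\<exists>!l. l < n \<and> P $$ (k, l) \<noteq> 0"
        using P that by (simp add: signed_permutation_mat_def)
      then have "P $$ (k, i) = 0 \<or> P $$ (k, j) = 0" using ij False by blast
      then show ?thesis by simp
    qed
    then have "(\<Sum>k<n. P $$ (k, i) * P $$ (k, j)) = 0" by (intro sum.neutral) auto
    then show ?thesis using prod False ij by simp
  qed
qed (use P in \<open>auto simp: signed_permutation_mat_def\<close>)

section \<open>Ambient graphs, degrees and regularity\<close>

lemma parcs_ambient_graph:
  assumes "seidel_mat n S"
  shows "parcs (ambient_graph S) = {(i, j). i < n \<and> j < n \<and> S $$ (i, j) = -1}"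
proof -
  have dim: "dim_row S = n" "dim_col S = n" and diag: "\<And>i. i < n \<Longrightarrow> S $$ (i, i) = 0"
    using assms by (auto simp: seidel_mat_def)
  show ?thesis
    by (auto simp: ambient_graph_def graph_of_adjacency_mat_def all_ones_mat_def dim diag
        split: if_splits)
qed

lemma seidel_mat_row_sum:
  assumes S: "seidel_mat n S" and i: "i < n"
  shows "(\<Sum>j<n. S $$ (i, j)) = real n - 1 - 2 * real (out_degree (with_proj (ambient_graph S)) i)"
proof -
  let ?A = "{j. j < n \<and> S $$ (i, j) = -1}"
  have "out_arcs (with_proj (ambient_graph S)) i = Pair i ` ?A"
    using i by (auto simp: out_arcs_def parcs_ambient_graph[OF S])
  then have deg: "out_degree (with_proj (ambient_graph S)) i = card ?A"
    by (simp add: out_degree_def card_image inj_on_def)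
  \<comment> \<open>Entrywise this is the identity S = J - I - 2A with A the adjacency matrix of the
    ambient graph.\<close>
  have "(\<Sum>j<n. S $$ (i, j)) = (\<Sum>j<n. 1 - (if j = i then 1 else 0) - 2 * (if S $$ (i, j) = -1 then 1 else 0))"
    using S i by (intro sum.cong) (fastforce simp: seidel_mat_def)+
  also have "\<dots> = real n - 1 - 2 * (\<Sum>j<n. if S $$ (i, j) = -1 then 1 else 0)"
    using i by (simp add: sum_subtractf sum_distrib_left)
  also have "(\<Sum>j<n. if S $$ (i, j) = -1 then 1 else 0) = real (card ?A)"
    by (simp add: sum.If_cases Int_def)
  finally show ?thesis using deg by simp
qed

text \<open>A switching class contains all isomorphic copies, so regularity has to be carried back
  to the ambient graph of an actual matrix.\<close>

lemma regular_graph_iso: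
  assumes "pair_graph G" "digraph_iso (with_proj G) (with_proj H)" "regular_graph H"
  shows "regular_graph G"
proof -
  interpret pair_graph G by fact
  from assms(2) obtain f where f: "digraph_isomorphism f" and H: "with_proj H = app_iso f (with_proj G)"
    by (auto simp: digraph_iso_def)
  from assms(3) obtain d where d: "\<And>v. v \<in> verts (with_proj H) \<Longrightarrow> out_degree (with_proj H) v = d"
    by (auto simp: regular_graph_def)
  have "out_degree (with_proj G) v = d" if "v \<in> pverts G" for v
    using out_degree_app_iso_eq[OF f, of v] d[of "iso_verts f v"] that by (simp add: H)
  then show ?thesis by (auto simp: regular_graph_def)
qed

text \<open>If \<open>T = P * S * transpose_mat P\<close> has all row sums equal to
  \<open>r\<close>, then the all-ones vector \<open>u\<close> is an eigenvector of \<open>T\<close>,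
  and \<open>transpose_mat P *\<^sub>v u\<close> is one of \<open>S\<close> for the same
  \<open>r\<close>.\<close>

lemma regular_switching_eigenvector:
  assumes S: "seidel_mat n S" and G: "G \<in> switching_class S" "regular_graph G"
  obtains r x where "r \<in> \<int>" "x \<in> carrier_vec n" "\<And>i. i < n \<Longrightarrow> x $ i \<in> {-1, 1}"
    "S *\<^sub>v x = r \<cdot>\<^sub>v x"
proof -
  from G(1) obtain T where T: "seidel_equiv S T"
    and iso: "digraph_iso (with_proj (ambient_graph T)) (with_proj G)"
    by (auto simp: switching_class_def)
  have dimS: "S \<in> carrier_mat n n" using S by (simp add: seidel_mat_def)
  from T dimS obtain P where seidelT: "seidel_mat n T" and P: "signed_permutation_mat n P"
    and T_eq: "T = P * S * transpose_mat P"
    unfolding seidel_equiv_def by (auto simp: seidel_mat_def)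
  have dimP: "P \<in> carrier_mat n n" using P by (simp add: signed_permutation_mat_def)
  have dimT: "T \<in> carrier_mat n n" using seidelT by (simp add: seidel_mat_def)
  have "regular_graph (ambient_graph T)"
    using regular_graph_iso[OF ambient_graph_simple[OF seidelT] iso G(2)] .
  then obtain d where d: "\<And>i. i < n \<Longrightarrow> out_degree (with_proj (ambient_graph T)) i = d"
    using dimT by (auto simp: regular_graph_def ambient_graph_def graph_of_adjacency_mat_def)
  define r where "r = real n - 1 - 2 * real d"
  define u :: "real vec" where "u = vec n (\<lambda>_. 1)"
  define x where "x = transpose_mat P *\<^sub>v u"
  have dims: "u \<in> carrier_vec n" "x \<in> carrier_vec n" "S *\<^sub>v x \<in> carrier_vec n"
    "transpose_mat P \<in> carrier_mat n n"
    using dimP dimS by (auto simp: u_def x_def)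
  have "T *\<^sub>v u = r \<cdot>\<^sub>v u"
  proof (rule eq_vecI)
    fix i assume "i < dim_vec (r \<cdot>\<^sub>v u)"
    then have "i < n" by (simp add: u_def)
    then show "(T *\<^sub>v u) $ i = (r \<cdot>\<^sub>v u) $ i"
      using seidel_mat_row_sum[OF seidelT, of i] d dimT
      by (simp add: u_def r_def scalar_prod_def atLeast0LessThan)
  qed (use dimT in \<open>simp add: u_def\<close>)
  moreover have "T *\<^sub>v u = P *\<^sub>v (S *\<^sub>v x)"
    using dimP dimS dims
    by (simp add: T_eq x_def assoc_mult_mat_vec[of _ n n _ n] assoc_mult_mat[of _ n n _ n _ n])
  ultimately have "transpose_mat P *\<^sub>v (P *\<^sub>v (S *\<^sub>v x)) = transpose_mat P *\<^sub>v (r \<cdot>\<^sub>v u)" by simp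
  also have "\<dots> = r \<cdot>\<^sub>v x" using dims by (simp add: x_def mult_mat_vec[of _ n n])
  \<comment> \<open>Orthogonality of \<open>P\<close> cancels the two outer factors.\<close>
  also have "transpose_mat P *\<^sub>v (P *\<^sub>v (S *\<^sub>v x)) = S *\<^sub>v x"
    using dimP dims signed_permutation_mat_orthogonal[OF P]
    by (simp flip: assoc_mult_mat_vec[of _ n n _ n])
  finally have "S *\<^sub>v x = r \<cdot>\<^sub>v x" .
  moreover have "x $ i \<in> {-1, 1}" if i: "i < n" for i
  proof -
    have "\<exists>e\<in>{-1, 1}. (\<Sum>j<n. transpose_mat P $$ (i, j)) = e"
      by (rule signed_permutation_mat_row_sum[OF signed_permutation_mat_transpose[OF P] i,
        where f = "\<lambda>t. t"]) simp
    moreover have "x $ i = (\<Sum>j<n. transpose_mat P $$ (i, j))"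
      using i dimP by (simp add: x_def u_def scalar_prod_def atLeast0LessThan)
    ultimately show ?thesis by simp
  qed
  moreover have "r \<in> \<int>" by (simp add: r_def)
  ultimately show ?thesis using that dims by blast
qed

section \<open>Block sums of an eigenvector of the Kronecker product\<close>

lemma card_residue_class_lessThan:
  fixes a n m :: nat
  assumes "a < n"
  shows "card {j. j < n * m \<and> j mod n = a} = m"
proof -
  have "{j. j < n * m \<and> j mod n = a} = (\<lambda>b. n * b + a) ` {..<m}"
  proof (intro equalityI subsetI)
    fix j assume j: "j \<in> {j. j < n * m \<and> j mod n = a}"
    then have "j = n * (j div n) + a" "j div n < m"
      using mult_div_mod_eq[of n j] by (auto simp: less_mult_imp_div_less mult.commute)
    then show "j \<in> (\<lambda>b. n * b + a) ` {..<m}" by blast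
  next
    fix j assume "j \<in> (\<lambda>b. n * b + a) ` {..<m}"
    then obtain b where b: "j = n * b + a" "b < m" by auto
    have "n * b + a < n * Suc b" using assms by simp
    also have "\<dots> \<le> n * m" using b by (intro mult_le_mono2) simp
    finally show "j \<in> {j. j < n * m \<and> j mod n = a}" using b assms by simp
  qed
  then show ?thesis using assms by (simp add: card_image inj_on_def)
qed

text \<open>The parity of a sum is that of the number of its odd terms. This is what keeps the block
  sums away from zero.\<close>

lemma odd_sum_of_odd:
  fixes f :: "'a \<Rightarrow> int"
  assumes "finite A" "odd (card A)" "\<And>x. x \<in> A \<Longrightarrow> odd (f x)"
  shows "odd (sum f A)"
proof -
  have "{x \<in> A. odd (f x)} = A" using assms(3) by blast
  then show ?thesis using assms(1,2) even_sum_iff[of A f] by simp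
qed

text \<open>With \<open>y\<close> the sum of the blocks of \<open>x\<close>, row \<open>i\<close> of
  the eigenvalue equation reads (S y - y) at \<open>i mod n\<close>, plus \<open>x $ i\<close>,
  equals \<open>r * x $ i\<close>. Adding the \<open>m\<close> rows of one residue class gives m (S
  y - y) + y = r y.\<close>

lemma kronecker_seidel_rational_eigenvalue:
  assumes S: "S \<in> carrier_mat n n" and "n > 0" and "odd m"
    and x: "x \<in> carrier_vec (n * m)" "\<And>i. i < n * m \<Longrightarrow> x $ i \<in> {-1, 1}" and r: "r \<in> \<rat>"
    and eig: "(all_ones_mat m \<otimes>\<^sub>K (S - 1\<^sub>m n) + 1\<^sub>m (n * m)) *\<^sub>v x = r \<cdot>\<^sub>v x" (is "?M *\<^sub>v x = _")
  obtains c where "c \<in> \<rat>" "eigenvalue S c"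
proof -
  \<comment> \<open>The all-ones matrix is the left factor, so an index is n b + a with block
    \<open>b\<close> and position \<open>a\<close>; \<open>C a\<close> collects position
    \<open>a\<close> of every block.\<close>
  define C where "C a = {j. j < n * m \<and> j mod n = a}" for a
  define y where "y = vec n (\<lambda>a. \<Sum>j\<in>C a. x $ j)"
  \<comment> \<open>The solution of m (c - 1) + 1 = r.\<close>
  define c where "c = (r - 1) / m + 1"
  have m: "m > 0" using \<open>odd m\<close> by (auto elim: oddE)
  have fin: "finite (C a)" for a by (simp add: C_def)
  have bound: "i div n < m \<and> i mod n < n" if "i < n * m" for i
    using that \<open>n > 0\<close> by (simp add: less_mult_imp_div_less mult.commute)
  have row: "(\<Sum>a<n. S $$ (i mod n, a) * y $ a) - y $ (i mod n) + x $ i = r * x $ i"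
    if i: "i < n * m" for i
  proof -
    let ?D = "\<lambda>a. S $$ (i mod n, a) - (if i mod n = a then 1 else 0)"
    have "r * x $ i = (?M *\<^sub>v x) $ i" using eig x(1) i by simp
    also have "\<dots> = (\<Sum>j<n * m. ?M $$ (i, j) * x $ j)"
      using i x(1) by (simp add: scalar_prod_def atLeast0LessThan)
    also have "\<dots> = (\<Sum>j<n * m. ?D (j mod n) * x $ j + (if i = j then x $ j else 0))"
      using i bound S
      by (intro sum.cong) (auto simp: kronecker_prod_def all_ones_mat_def mult.commute algebra_simps)
    also have "\<dots> = (\<Sum>j<n * m. ?D (j mod n) * x $ j) + x $ i"
      using i by (simp add: sum.distrib)
    \<comment> \<open>The coefficient depends on \<open>j\<close> only through
      \<open>j mod n\<close>, so the columns can be grouped by residue.\<close>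
    also have "(\<Sum>j<n * m. ?D (j mod n) * x $ j)
        = (\<Sum>a<n. \<Sum>j | j \<in> {..<n * m} \<and> j mod n = a. ?D (j mod n) * x $ j)"
      using bound by (intro sum.group[symmetric]) auto
    also have "\<dots> = (\<Sum>a<n. ?D a * y $ a)"
      by (intro sum.cong) (auto simp: y_def C_def sum_distrib_left intro!: sum.cong)
    also have "\<dots> = (\<Sum>a<n. S $$ (i mod n, a) * y $ a) - (\<Sum>a<n. if i mod n = a then y $ a else 0)"
      unfolding sum_subtractf[symmetric] by (intro sum.cong) (auto simp: algebra_simps)
    also have "(\<Sum>a<n. if i mod n = a then y $ a else 0) = y $ (i mod n)"
      using bound[OF i] by simp
    finally show ?thesis by simp
  qed
  have "S *\<^sub>v y = c \<cdot>\<^sub>v y"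
  proof (rule eq_vecI)
    fix a assume "a < dim_vec (c \<cdot>\<^sub>v y)"
    then have a: "a < n" by (simp add: y_def)
    let ?s = "\<Sum>b<n. S $$ (a, b) * y $ b"
    \<comment> \<open>Along \<open>C a\<close> the first two terms are constant, and the entries of
      \<open>x\<close> add up to \<open>y $ a\<close>.\<close>
    have "(\<Sum>i\<in>C a. ?s - y $ a + x $ i) = (\<Sum>i\<in>C a. r * x $ i)"
      using row by (intro sum.cong) (auto simp: C_def)
    moreover have "card (C a) = m" unfolding C_def by (rule card_residue_class_lessThan[OF a])
    moreover have "(\<Sum>i\<in>C a. x $ i) = y $ a" using a by (simp add: y_def)
    ultimately have "m * (?s - y $ a) + y $ a = r * y $ a"
      by (simp add: sum.distrib flip: sum_distrib_left)
    then have "?s = c * y $ a" using m by (simp add: c_def field_simps)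
    then show "(S *\<^sub>v y) $ a = (c \<cdot>\<^sub>v y) $ a"
      using a S by (simp add: y_def scalar_prod_def atLeast0LessThan)
  qed (use S in \<open>simp add: y_def\<close>)
  moreover have "y \<noteq> 0\<^sub>v n"
  proof
    assume "y = 0\<^sub>v n"
    then have "y $ 0 = 0" using \<open>n > 0\<close> by simp
    then have "(\<Sum>j\<in>C 0. x $ j) = 0" using \<open>n > 0\<close> by (simp add: y_def)
    \<comment> \<open>The entries are real numbers equal to 1 or -1; floors turn the sum into one of
      integers, where parity makes sense.\<close>
    also have "(\<Sum>j\<in>C 0. x $ j) = (\<Sum>j\<in>C 0. of_int \<lfloor>x $ j\<rfloor>)"
      using x(2) by (intro sum.cong) (fastforce simp: C_def)+
    finally have "(\<Sum>j\<in>C 0. \<lfloor>x $ j\<rfloor>) = 0" by (simp flip: of_int_sum)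
    moreover have "odd (\<Sum>j\<in>C 0. \<lfloor>x $ j\<rfloor>)"
    proof (rule odd_sum_of_odd[OF fin])
      show "odd (card (C 0))"
        unfolding C_def card_residue_class_lessThan[OF \<open>n > 0\<close>] by fact
      fix j assume "j \<in> C 0"
      then have "x $ j = of_int (-1) \<or> x $ j = of_int 1" using x(2)[of j] by (auto simp: C_def)
      then show "odd \<lfloor>x $ j\<rfloor>" by (elim disjE) (simp_all only: floor_of_int, simp_all)
    qed
    ultimately show False by simp
  qed
  ultimately have "eigenvalue S c"
    using S unfolding eigenvalue_def eigenvector_def by (intro exI[of _ y]) (simp add: y_def)
  moreover have "c \<in> \<rat>" using r by (simp add: c_def)
  ultimately show ?thesis by (rule that[rotated])
qed

section \<open>Contradiction with the irrational spectrum, for both signs\<close>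

theorem mainTheorem3:
  fixes S\<^sub>6 :: "real mat" and k :: nat
  assumes "seidel_mat 6 S\<^sub>6"
    and "proots (char_poly S\<^sub>6) = replicate_mset 3 (- sqrt 5) + replicate_mset 3 (sqrt 5)"
    and "k \<in> {1, 2}"
  shows "let M = all_ones_mat (2 * k + 1) \<otimes>\<^sub>K (S\<^sub>6 - 1\<^sub>m 6) + 1\<^sub>m (6 * (2 * k + 1))
         in \<forall>T \<in> {M, - M}. \<not> (\<exists>G \<in> switching_class T. regular_graph G)"
proof -
  define n where "n = 6 * (2 * k + 1)"
  define M where "M = all_ones_mat (2 * k + 1) \<otimes>\<^sub>K (S\<^sub>6 - 1\<^sub>m 6) + 1\<^sub>m n"
  have dim: "S\<^sub>6 \<in> carrier_mat 6 6" using assms(1) by (simp add: seidel_mat_def)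
  have irrational: "c \<notin> \<rat>" if "eigenvalue S\<^sub>6 c" for c
  proof -
    \<comment> \<open>Membership in \<open>proots\<close> characterises the roots of a non-zero
      polynomial.\<close>
    have "char_poly S\<^sub>6 \<noteq> 0" using degree_monic_char_poly[OF dim] by auto
    then have "c \<in># proots (char_poly S\<^sub>6)"
      using that by (simp add: eigenvalue_root_char_poly[OF dim])
    then have "c = sqrt 5 \<or> c = - sqrt 5"
      unfolding assms(2) by (auto split: if_splits)
    then show ?thesis using sqrt_5_irrational by (auto simp: Rats_minus_iff)
  qed
  have M: "seidel_mat n M"
    unfolding M_def n_def by (rule seidel_mat_kronecker[OF assms(1)])
  have "\<forall>T \<in> {M, - M}. \<not> (\<exists>G \<in> switching_class T. regular_graph G)"
  proof (intro ballI notI, elim bexE)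
    fix T G assume T: "T \<in> {M, - M}" and G: "G \<in> switching_class T" "regular_graph G"
    have "seidel_mat n T" using T M seidel_mat_uminus[OF M] by auto
    from regular_switching_eigenvector[OF this G] obtain r x where r: "r \<in> \<int>"
      and x: "x \<in> carrier_vec n" "\<And>i. i < n \<Longrightarrow> x $ i \<in> {-1, 1}" and eig: "T *\<^sub>v x = r \<cdot>\<^sub>v x"
      by blast
    have dimM: "M \<in> carrier_mat n n" using M by (simp add: seidel_mat_def)
    \<comment> \<open>Both signs reduce to \<open>M\<close>: an eigenvector of \<open>- M\<close>
      for \<open>r\<close> is one of \<open>M\<close> for \<open>- r\<close>.\<close>
    obtain s where s: "s \<in> \<rat>" "M *\<^sub>v x = s \<cdot>\<^sub>v x"
    proof (cases "T = M")
      case True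
      with eig have "M *\<^sub>v x = r \<cdot>\<^sub>v x" by simp
      with r show ?thesis by (intro that[of r]) (auto elim: Ints_cases)
    next
      case False
      with T have T_eq: "T = - M" by simp
      have "M *\<^sub>v x = (- r) \<cdot>\<^sub>v x"
      proof (rule eq_vecI)
        fix i assume "i < dim_vec (- r \<cdot>\<^sub>v x)"
        then have "i < n" using x(1) by simp
        then have "(T *\<^sub>v x) $ i = - ((M *\<^sub>v x) $ i)"
          using dimM x(1) by (simp add: T_eq)
        then show "(M *\<^sub>v x) $ i = (- r \<cdot>\<^sub>v x) $ i"
          unfolding eig using \<open>i < n\<close> x(1) by simp
      qed (use dimM x(1) in simp)
      with r show ?thesis by (intro that[of "- r"]) (auto elim: Ints_cases)
    qed
    show False
    proof (rule kronecker_seidel_rational_eigenvalue[OF dim _ _ _ _ s(1)])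
      show "x \<in> carrier_vec (6 * (2 * k + 1))" using x(1) unfolding n_def .
      show "x $ i \<in> {-1, 1}" if "i < 6 * (2 * k + 1)" for i
        using x(2) that unfolding n_def .
      show "(all_ones_mat (2 * k + 1) \<otimes>\<^sub>K (S\<^sub>6 - 1\<^sub>m 6) + 1\<^sub>m (6 * (2 * k + 1))) *\<^sub>v x = s \<cdot>\<^sub>v x"
        using s(2) unfolding M_def n_def .
    qed (use irrational in auto)
  qed
  then show ?thesis unfolding Let_def M_def n_def .
qed

end
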